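(* Let $(\gamma, \bm n_1, \bm n_2) : I \to \mathbb H^p \times \Delta$ be a non-parabolic spatial hybrid framed curve with curvature $(L, M, 0, \alpha)$, where $M(t)>0$ and $L(t) \neq 0$ for all $t \in I$, and let $\bm\mu = \bm n_1\times\bm n_2$. Let $\bm p \in \mathbb H^p$ be a fixed point. Let $\mathcal Ev_\gamma$ be the evolute and $\mathcal Inv_\gamma$ an involute of $(\gamma,\bm n_1,\bm n_2)$. Then, with all pedal and contrapedal curves taken relative to $\bm p$: the pedal curve of the evolute $(\mathcal Ev_\gamma, \bm n_1, \bm\mu)$ coincides with the contrapedal curve of $(\gamma, \bm n_1, \bm n_2)$, and the contrapedal curve of the involute $(\mathcal Inv_\gamma, \bm n_1, \bm\mu)$ coincides with the pedal curve of $(\gamma, \bm n_1, \bm n_2)$.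
   Context: All maps are $C^\infty$; $I\subseteq\mathbb R$ is an interval. $\mathbb H^p = \{b\bm i + c\bm\varepsilon + d\bm h : b,c,d\in\mathbb R\}$ is the 3-dimensional real vector space with basis $\{\bm i,\bm\varepsilon,\bm h\}$. For $\bm H_k = b_k \bm i + c_k \bm\varepsilon + d_k \bm h$, the scalar product is $g(\bm H_1,\bm H_2) = b_1b_2 - b_1c_2 - b_2c_1 - d_1d_2$; the norm is $\|\bm H\| = \sqrt{|g(\bm H,\bm H)|}$; the vector product is $$\bm H_1 \times \bm H_2 = (b_2d_1 - b_1d_2)\bm i + (b_2d_1 - b_1d_2 - c_2d_1 + c_1d_2)\bm\varepsilon + (b_1c_2 - b_2c_1)\bm h.$$ Let $\Delta = \{(\bm\nu_1, \bm\nu_2) \in \mathbb H^p \times \mathbb H^p : \|\bm\nu_1\| = \|\bm\nu_2\| = 1,\ g(\bm\nu_1, \bm\nu_2) = 0\}$. Non-parabolic spatial hybrid framed curve: a smooth map $(\gamma, \bm\nu_1, \bm\nu_2) : I \to \mathbb H^p \times \Delta$ with $g(\gamma'(t), \bm\nu_1(t)) = g(\gamma'(t), \bm\nu_2(t)) = 0$ for all $t \in I$. Put $\bm\mu = \bm\nu_1\times\bm\nu_2$ and $s_1 = g(\bm\nu_1,\bm\nu_1)$, $s_2 = g(\bm\nu_2,\bm\nu_2)$ (constants in $\{1,-1\}$; $g(\bm\mu,\bm\mu)=s_1s_2$). Its curvature is $(l,m,n,\alpha): I\to\mathbb R^4$, where $$l = s_2 g(\bm\nu_1',\bm\nu_2),\quad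 m = s_1s_2 g(\bm\nu_1',\bm\mu),\quad n = s_1s_2 g(\bm\nu_2',\bm\mu),\quad \alpha = s_1s_2 g(\gamma',\bm\mu);$$ equivalently $\gamma' = \alpha\bm\mu$, $\bm\nu_1' = l\bm\nu_2 + m\bm\mu$, $\bm\nu_2' = -s_1s_2 l\bm\nu_1 + n\bm\mu$, $\bm\mu' = -s_2 m\bm\nu_1 - s_1 n\bm\nu_2$. Evolute: for a non-parabolic spatial hybrid framed curve $(\gamma,\bm\nu_1,\bm\nu_2)$ with curvature $(l,m,n,\alpha)$ such that $D(t) := m(t)n'(t) - m'(t)n(t) + s_1s_2 l(t)m^2(t) + l(t)n^2(t)\neq 0$ for all $t\in I$, its evolute is the map $\mathcal Ev_\gamma: I\to\mathbb H^p$, $$\mathcal Ev_\gamma = \gamma - \frac{n'\alpha - n\alpha' + s_1s_2\, l m\alpha}{D}\,\bm\nu_1 - \frac{m\alpha' - m'\alpha + l n\alpha}{D}\,\bm\nu_2 .$$ For curvature $(L,M,0,\alpha)$ with $L,M$ nowhere zero this reads $\mathcal Ev_\gamma = \gamma - \frac{\alpha}{M}\bm n_1 - g(\bm\mu,\bm\mu)\frac{M\alpha'-M'\alpha}{LM^2}\bm n_2$, and $(\mathcal Ev_\gamma,\bm n_1,\bm\mu)$ is a non-parabolic spatial hybrid framed curve. Involute: for a non-parabolic spatial hybrid framed curve $(\gamma,\bm n_1,\bm n_2)$ with curvature $(L,M,0,\alpha)$, put $\sigma = g(\bm n_1,\bm n_1)$ and $\bm\mu = \bm n_1\times\bm n_2$.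 An involute is a map $\mathcal Inv_\gamma: I\to\mathbb H^p$, $$\mathcal Inv_\gamma(t) = \gamma(t) + f_1(t)\bm n_1(t) + f_2(t)\bm\mu(t),$$ where $(f_1,f_2)$ is a solution on $I$ of $f_1' = \sigma\, g(\bm\mu,\bm\mu)\, M f_2$, $f_2' = -M f_1 - \alpha$. The triple $(\mathcal Inv_\gamma,\bm n_1,\bm\mu)$ is a non-parabolic spatial hybrid framed curve. Pedal and contrapedal curves: for a non-parabolic spatial hybrid framed curve $(\beta,\bm a_1,\bm a_2)$ whose curvature has vanishing third component, and a point $\bm p\in\mathbb H^p$, put $\bm a_3 = \bm a_1\times\bm a_2$. The pedal curve relative to $\bm p$ is $$t\mapsto \bm p - g(\bm a_2(t),\bm a_2(t))\, g(\bm p-\beta(t),\bm a_2(t))\,\bm a_2(t),$$ and the contrapedal curve relative to $\bm p$ is $$t\mapsto \bm p - g(\bm a_3(t),\bm a_3(t))\, g(\bm p-\beta(t),\bm a_3(t))\,\bm a_3(t).$$ These apply to $(\gamma,\bm n_1,\bm n_2)$ and also to $(\mathcal Ev_\gamma,\bm n_1,\bm\mu)$ and $(\mathcal Inv_\gamma,\bm n_1,\bm\mu)$, for which $\bm a_2=\bm\mu$ and $\bm a_3 = \bm n_1\times\bm\mu = -\sigma\bm n_2$. *)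

theory Defs
  imports "HOL-Analysis.Analysis"
begin

text \<open>
  The vector \<open>b i + c \<epsilon> + d h\<close> is represented by its coordinates \<open>(b, c, d)\<close> in \<open>real ^ 3\<close>.
  The Euclidean structure of \<open>real ^ 3\<close> is used only for differentiation; the geometry is given
  by the indefinite scalar product \<open>hprod\<close> and the norm \<open>hnorm\<close> below.
\<close>

type_synonym hvec = "real ^ 3"

definition hprod :: "hvec \<Rightarrow> hvec \<Rightarrow> real" where
  "hprod X Y = X$1 * Y$1 - X$1 * Y$2 - Y$1 * X$2 - X$3 * Y$3"

definition hnorm :: "hvec \<Rightarrow> real" where
  "hnorm X = sqrt \<bar>hprod X X\<bar>"

definition hcross :: "hvec \<Rightarrow> hvec \<Rightarrow> hvec" where
  "hcross X Y = vector
     [Y$1 * X$3 - X$1 * Y$3,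
      Y$1 * X$3 - X$1 * Y$3 - Y$2 * X$3 + X$2 * Y$3,
      X$1 * Y$2 - Y$1 * X$2]"

definition hDelta :: "(hvec \<times> hvec) set" where
  "hDelta = {(X, Y). hnorm X = 1 \<and> hnorm Y = 1 \<and> hprod X Y = 0}"

text \<open>
  Derivatives on the parameter interval \<open>I\<close> are taken within \<open>I\<close>, hence are one-sided at an
  endpoint belonging to \<open>I\<close>. They are unique when \<open>I\<close> has more than one point.
\<close>

definition deriv_on :: "real set \<Rightarrow> (real \<Rightarrow> 'a::real_normed_vector) \<Rightarrow> real \<Rightarrow> 'a" where
  "deriv_on I f t = vector_derivative f (at t within I)"

definition smooth_on :: "real set \<Rightarrow> (real \<Rightarrow> 'a::real_normed_vector) \<Rightarrow> bool" where
  "smooth_on I f \<longleftrightarrow> (\<forall>k. (deriv_on I ^^ k) f differentiable_on I)"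

text \<open>
  \<open>framed_curve\<close> is the notion of non-parabolic spatial hybrid framed curve; smoothness of
  \<open>(\<gamma>, \<nu>\<^sub>1, \<nu>\<^sub>2)\<close> is stated componentwise.
\<close>

definition framed_curve ::
    "real set \<Rightarrow> (real \<Rightarrow> hvec) \<Rightarrow> (real \<Rightarrow> hvec) \<Rightarrow> (real \<Rightarrow> hvec) \<Rightarrow> bool" where
  "framed_curve I \<gamma> \<nu>\<^sub>1 \<nu>\<^sub>2 \<longleftrightarrow>
     smooth_on I \<gamma> \<and> smooth_on I \<nu>\<^sub>1 \<and> smooth_on I \<nu>\<^sub>2 \<and>
     (\<forall>t\<in>I. (\<nu>\<^sub>1 t, \<nu>\<^sub>2 t) \<in> hDelta \<and>
        hprod (deriv_on I \<gamma> t) (\<nu>\<^sub>1 t) = 0 \<and> hprod (deriv_on I \<gamma> t) (\<nu>\<^sub>2 t) = 0)"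

definition frame_mu :: "(real \<Rightarrow> hvec) \<Rightarrow> (real \<Rightarrow> hvec) \<Rightarrow> real \<Rightarrow> hvec" where
  "frame_mu \<nu>\<^sub>1 \<nu>\<^sub>2 t = hcross (\<nu>\<^sub>1 t) (\<nu>\<^sub>2 t)"

text \<open>The sign \<open>hprod (\<nu> t) (\<nu> t)\<close>, which does not depend on \<open>t\<close> along a framed curve.\<close>

definition frame_sign :: "(real \<Rightarrow> hvec) \<Rightarrow> real \<Rightarrow> real" where
  "frame_sign \<nu> t = hprod (\<nu> t) (\<nu> t)"

definition curv_l :: "real set \<Rightarrow> (real \<Rightarrow> hvec) \<Rightarrow> (real \<Rightarrow> hvec) \<Rightarrow> real \<Rightarrow> real" where
  "curv_l I \<nu>\<^sub>1 \<nu>\<^sub>2 t = frame_sign \<nu>\<^sub>2 t * hprod (deriv_on I \<nu>\<^sub>1 t) (\<nu>\<^sub>2 t)"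

definition curv_m :: "real set \<Rightarrow> (real \<Rightarrow> hvec) \<Rightarrow> (real \<Rightarrow> hvec) \<Rightarrow> real \<Rightarrow> real" where
  "curv_m I \<nu>\<^sub>1 \<nu>\<^sub>2 t =
     frame_sign \<nu>\<^sub>1 t * frame_sign \<nu>\<^sub>2 t * hprod (deriv_on I \<nu>\<^sub>1 t) (frame_mu \<nu>\<^sub>1 \<nu>\<^sub>2 t)"

definition curv_n :: "real set \<Rightarrow> (real \<Rightarrow> hvec) \<Rightarrow> (real \<Rightarrow> hvec) \<Rightarrow> real \<Rightarrow> real" where
  "curv_n I \<nu>\<^sub>1 \<nu>\<^sub>2 t =
     frame_sign \<nu>\<^sub>1 t * frame_sign \<nu>\<^sub>2 t * hprod (deriv_on I \<nu>\<^sub>2 t) (frame_mu \<nu>\<^sub>1 \<nu>\<^sub>2 t)"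

definition curv_alpha ::
    "real set \<Rightarrow> (real \<Rightarrow> hvec) \<Rightarrow> (real \<Rightarrow> hvec) \<Rightarrow> (real \<Rightarrow> hvec) \<Rightarrow> real \<Rightarrow> real" where
  "curv_alpha I \<gamma> \<nu>\<^sub>1 \<nu>\<^sub>2 t =
     frame_sign \<nu>\<^sub>1 t * frame_sign \<nu>\<^sub>2 t * hprod (deriv_on I \<gamma> t) (frame_mu \<nu>\<^sub>1 \<nu>\<^sub>2 t)"

definition curvature ::
    "real set \<Rightarrow> (real \<Rightarrow> hvec) \<Rightarrow> (real \<Rightarrow> hvec) \<Rightarrow> (real \<Rightarrow> hvec) \<Rightarrow> real
       \<Rightarrow> real \<times> real \<times> real \<times> real" where
  "curvature I \<gamma> \<nu>\<^sub>1 \<nu>\<^sub>2 t =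
     (curv_l I \<nu>\<^sub>1 \<nu>\<^sub>2 t, curv_m I \<nu>\<^sub>1 \<nu>\<^sub>2 t, curv_n I \<nu>\<^sub>1 \<nu>\<^sub>2 t, curv_alpha I \<gamma> \<nu>\<^sub>1 \<nu>\<^sub>2 t)"

text \<open>
  The evolute is meaningful for framed curves with \<open>evolute_denom\<close> nowhere zero on \<open>I\<close>.
  For curvature \<open>(L, M, 0, \<alpha>)\<close> this denominator is \<open>s\<^sub>1 s\<^sub>2 L M\<^sup>2\<close>.
\<close>

definition evolute_denom ::
    "real set \<Rightarrow> (real \<Rightarrow> hvec) \<Rightarrow> (real \<Rightarrow> hvec) \<Rightarrow> real \<Rightarrow> real" where
  "evolute_denom I \<nu>\<^sub>1 \<nu>\<^sub>2 t =
     (let s\<^sub>1 = frame_sign \<nu>\<^sub>1 t; s\<^sub>2 = frame_sign \<nu>\<^sub>2 t;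
          l = curv_l I \<nu>\<^sub>1 \<nu>\<^sub>2; m = curv_m I \<nu>\<^sub>1 \<nu>\<^sub>2; n = curv_n I \<nu>\<^sub>1 \<nu>\<^sub>2
      in m t * deriv_on I n t - deriv_on I m t * n t
           + s\<^sub>1 * s\<^sub>2 * l t * (m t)\<^sup>2 + l t * (n t)\<^sup>2)"

definition evolute ::
    "real set \<Rightarrow> (real \<Rightarrow> hvec) \<Rightarrow> (real \<Rightarrow> hvec) \<Rightarrow> (real \<Rightarrow> hvec) \<Rightarrow> real \<Rightarrow> hvec" where
  "evolute I \<gamma> \<nu>\<^sub>1 \<nu>\<^sub>2 t =
     (let s\<^sub>1 = frame_sign \<nu>\<^sub>1 t; s\<^sub>2 = frame_sign \<nu>\<^sub>2 t;
          l = curv_l I \<nu>\<^sub>1 \<nu>\<^sub>2; m = curv_m I \<nu>\<^sub>1 \<nu>\<^sub>2; n = curv_n I \<nu>\<^sub>1 \<nu>\<^sub>2;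
          \<alpha> = curv_alpha I \<gamma> \<nu>\<^sub>1 \<nu>\<^sub>2; D = evolute_denom I \<nu>\<^sub>1 \<nu>\<^sub>2 t
      in \<gamma> t
         - ((deriv_on I n t * \<alpha> t - n t * deriv_on I \<alpha> t + s\<^sub>1 * s\<^sub>2 * l t * m t * \<alpha> t) / D) *\<^sub>R \<nu>\<^sub>1 t
         - ((m t * deriv_on I \<alpha> t - deriv_on I m t * \<alpha> t + l t * n t * \<alpha> t) / D) *\<^sub>R \<nu>\<^sub>2 t)"

text \<open>
  Involutes are not unique: each solution of the linear system for \<open>(f\<^sub>1, f\<^sub>2)\<close> gives one.
  The notion is meaningful for framed curves with vanishing third curvature component.
\<close>

definition is_involute ::
    "real set \<Rightarrow> (real \<Rightarrow> hvec) \<Rightarrow> (real \<Rightarrow> hvec) \<Rightarrow> (real \<Rightarrow> hvec) \<Rightarrow> (real \<Rightarrow> hvec) \<Rightarrow> bool" where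
  "is_involute I \<gamma> n\<^sub>1 n\<^sub>2 Inv\<gamma> \<longleftrightarrow>
     (\<exists>f\<^sub>1 f\<^sub>2 :: real \<Rightarrow> real. \<forall>t\<in>I.
        (f\<^sub>1 has_real_derivative
           frame_sign n\<^sub>1 t * frame_sign (frame_mu n\<^sub>1 n\<^sub>2) t * curv_m I n\<^sub>1 n\<^sub>2 t * f\<^sub>2 t) (at t within I) \<and>
        (f\<^sub>2 has_real_derivative
           - curv_m I n\<^sub>1 n\<^sub>2 t * f\<^sub>1 t - curv_alpha I \<gamma> n\<^sub>1 n\<^sub>2 t) (at t within I) \<and>
        Inv\<gamma> t = \<gamma> t + f\<^sub>1 t *\<^sub>R n\<^sub>1 t + f\<^sub>2 t *\<^sub>R frame_mu n\<^sub>1 n\<^sub>2 t)"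

text \<open>
  Pedal and contrapedal curves of \<open>(\<beta>, a\<^sub>1, a\<^sub>2)\<close> relative to \<open>p\<close>, meaningful for framed curves with
  vanishing third curvature component. The pedal curve does not use \<open>a\<^sub>1\<close>; it is kept as
  an argument because the notion belongs to the framed curve and not to \<open>\<beta>\<close> alone.
\<close>

definition pedal ::
    "hvec \<Rightarrow> (real \<Rightarrow> hvec) \<Rightarrow> (real \<Rightarrow> hvec) \<Rightarrow> (real \<Rightarrow> hvec) \<Rightarrow> real \<Rightarrow> hvec" where
  "pedal p \<beta> a\<^sub>1 a\<^sub>2 t = p - (hprod (a\<^sub>2 t) (a\<^sub>2 t) * hprod (p - \<beta> t) (a\<^sub>2 t)) *\<^sub>R a\<^sub>2 t"

definition contrapedal ::
    "hvec \<Rightarrow> (real \<Rightarrow> hvec) \<Rightarrow> (real \<Rightarrow> hvec) \<Rightarrow> (real \<Rightarrow> hvec) \<Rightarrow> real \<Rightarrow> hvec" where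
  "contrapedal p \<beta> a\<^sub>1 a\<^sub>2 t =
     (let a\<^sub>3 = frame_mu a\<^sub>1 a\<^sub>2 in p - (hprod (a\<^sub>3 t) (a\<^sub>3 t) * hprod (p - \<beta> t) (a\<^sub>3 t)) *\<^sub>R a\<^sub>3 t)"

end

theory Submission
  imports Defs
begin

text \<open>
  A pedal curve sees its base curve \<open>\<beta>\<close> only through the number \<open>g(p - \<beta>, a)\<close>, where \<open>a\<close> is the
  frame vector onto which the projection is made (\<open>a = a\<^sub>2\<close> for the pedal and \<open>a = a\<^sub>3\<close> for the
  contrapedal curve). Moving \<open>\<beta>\<close> along directions orthogonal to \<open>a\<close> therefore changes nothing,
  and replacing \<open>a\<close> by \<open>c a\<close> with \<open>c\<^sup>2 = 1\<close> changes nothing either, because \<open>a\<close> occurs four times.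

  The evolute differs from \<open>\<gamma>\<close> by a combination of \<open>n\<^sub>1\<close> and \<open>n\<^sub>2\<close>, both orthogonal to
  \<open>\<mu> = n\<^sub>1 \<times> n\<^sub>2\<close>. Since \<open>\<mu>\<close> is the vector of projection both for the pedal curve of
  \<open>(evolute, n\<^sub>1, \<mu>)\<close> and for the contrapedal curve of \<open>(\<gamma>, n\<^sub>1, n\<^sub>2)\<close>, the two curves agree.

  An involute differs from \<open>\<gamma>\<close> by a combination of \<open>n\<^sub>1\<close> and \<open>\<mu>\<close>, both orthogonal to \<open>n\<^sub>2\<close>. The
  contrapedal curve of \<open>(involute, n\<^sub>1, \<mu>)\<close> projects onto \<open>n\<^sub>1 \<times> \<mu>\<close>, which is
  \<open>-g(n\<^sub>1, n\<^sub>1) n\<^sub>2\<close> by the triple product formula, and \<open>g(n\<^sub>1, n\<^sub>1) = \<plusminus>1\<close>.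

  Both coincidences are thus pointwise facts about \<open>g\<close> and \<open>\<times>\<close>.
\<close>

lemma hprod_add_left: "hprod (X + Y) Z = hprod X Z + hprod Y Z"
  by (simp add: hprod_def algebra_simps)

lemma hprod_diff_left: "hprod (X - Y) Z = hprod X Z - hprod Y Z"
  by (simp add: hprod_def algebra_simps)

lemma hprod_scaleR_left: "hprod (c *\<^sub>R X) Z = c * hprod X Z"
  by (simp add: hprod_def algebra_simps)

lemma hprod_scaleR_right: "hprod X (c *\<^sub>R Z) = c * hprod X Z"
  by (simp add: hprod_def algebra_simps)

lemma hprod_hcross_left: "hprod X (hcross X Y) = 0"
  by (simp add: hprod_def hcross_def algebra_simps)

lemma hprod_hcross_right: "hprod Y (hcross X Y) = 0"
  by (simp add: hprod_def hcross_def algebra_simps)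

lemma hprod_commute: "hprod X Y = hprod Y X"
  by (simp add: hprod_def)

text \<open>
  For orthogonal \<open>X\<close> and \<open>Y\<close> only \<open>- g(X, X) Y\<close> remains: this is why the third frame vector of
  \<open>(involute, n\<^sub>1, \<mu>)\<close> is parallel to \<open>n\<^sub>2\<close>.
\<close>

lemma hcross_hcross: "hcross X (hcross X Y) = hprod X Y *\<^sub>R X - hprod X X *\<^sub>R Y"
  by (simp add: hprod_def hcross_def vec_eq_iff forall_3 algebra_simps)

lemma hnorm_eq_1_imp_hprod_square: "hnorm X = 1 \<Longrightarrow> hprod X X * hprod X X = 1"
  by (auto simp: hnorm_def abs_if split: if_splits)

text \<open>
  When \<open>g(a, a) = \<plusminus>1\<close>, this is the foot of the \<open>g\<close>-perpendicular from \<open>p\<close> to the plane through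
  \<open>B\<close> with normal \<open>a\<close>; pedal and contrapedal curves differ only in the choice of that normal.
\<close>

definition foot :: "hvec \<Rightarrow> hvec \<Rightarrow> hvec \<Rightarrow> hvec" where
  "foot p B a = p - (hprod a a * hprod (p - B) a) *\<^sub>R a"

lemma pedal_eq_foot: "pedal p \<beta> a\<^sub>1 a\<^sub>2 t = foot p (\<beta> t) (a\<^sub>2 t)"
  by (simp add: pedal_def foot_def)

lemma contrapedal_eq_foot: "contrapedal p \<beta> a\<^sub>1 a\<^sub>2 t = foot p (\<beta> t) (frame_mu a\<^sub>1 a\<^sub>2 t)"
  by (simp add: contrapedal_def foot_def Let_def)

lemma foot_cong_hprod: "hprod B a = hprod C a \<Longrightarrow> foot p B a = foot p C a"
  by (simp add: foot_def hprod_diff_left)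

lemma foot_scaleR_unit:
  assumes "c * c = 1"
  shows "foot p B (c *\<^sub>R a) = foot p B a"
proof -
  have "c * (c * hprod a a) * (c * hprod (p - B) a) * c
      = (c * c) * (c * c) * (hprod a a * hprod (p - B) a)"
    by (simp add: algebra_simps)
  then show ?thesis
    using assms by (simp add: foot_def hprod_scaleR_left hprod_scaleR_right)
qed

text \<open>
  The displacement from \<open>\<gamma>\<close> to its evolute lies in the plane spanned by \<open>n\<^sub>1\<close> and \<open>n\<^sub>2\<close>, whose
  normal direction is \<open>\<mu>\<close>.
\<close>

lemma hprod_evolute_frame_mu:
  "hprod (evolute I \<gamma> n\<^sub>1 n\<^sub>2 t) (frame_mu n\<^sub>1 n\<^sub>2 t) = hprod (\<gamma> t) (frame_mu n\<^sub>1 n\<^sub>2 t)"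
  by (simp add: evolute_def Let_def frame_mu_def hprod_diff_left hprod_scaleR_left
      hprod_hcross_left hprod_hcross_right)

theorem theorem4p8:
  fixes I :: "real set"
    and \<gamma> n\<^sub>1 n\<^sub>2 \<mu> Inv\<gamma> :: "real \<Rightarrow> hvec"
    and L M \<alpha> :: "real \<Rightarrow> real"
    and p :: hvec
  assumes "is_interval I" and "interior I \<noteq> {}"
    and "framed_curve I \<gamma> n\<^sub>1 n\<^sub>2"
    and "\<forall>t\<in>I. curvature I \<gamma> n\<^sub>1 n\<^sub>2 t = (L t, M t, 0, \<alpha> t)"
    and "\<forall>t\<in>I. M t > 0 \<and> L t \<noteq> 0"
    and "\<mu> = frame_mu n\<^sub>1 n\<^sub>2"
    and "is_involute I \<gamma> n\<^sub>1 n\<^sub>2 Inv\<gamma>"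
  shows "(\<forall>t\<in>I. pedal p (evolute I \<gamma> n\<^sub>1 n\<^sub>2) n\<^sub>1 \<mu> t = contrapedal p \<gamma> n\<^sub>1 n\<^sub>2 t) \<and>
         (\<forall>t\<in>I. contrapedal p Inv\<gamma> n\<^sub>1 \<mu> t = pedal p \<gamma> n\<^sub>1 n\<^sub>2 t)"
proof (intro conjI ballI)
  fix t
  show "pedal p (evolute I \<gamma> n\<^sub>1 n\<^sub>2) n\<^sub>1 \<mu> t = contrapedal p \<gamma> n\<^sub>1 n\<^sub>2 t"
    unfolding pedal_eq_foot contrapedal_eq_foot assms(6)
    by (rule foot_cong_hprod) (rule hprod_evolute_frame_mu)
next
  fix t
  assume t: "t \<in> I"
  let ?\<sigma> = "hprod (n\<^sub>1 t) (n\<^sub>1 t)"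
  from assms(3) t have unit: "hnorm (n\<^sub>1 t) = 1" and orth: "hprod (n\<^sub>1 t) (n\<^sub>2 t) = 0"
    by (auto simp: framed_curve_def hDelta_def)
  have "frame_mu n\<^sub>1 \<mu> t = (- ?\<sigma>) *\<^sub>R n\<^sub>2 t"
    by (simp add: assms(6) frame_mu_def hcross_hcross orth)
  moreover have "(- ?\<sigma>) * (- ?\<sigma>) = 1"
    using hnorm_eq_1_imp_hprod_square[OF unit] by simp
  ultimately have "contrapedal p Inv\<gamma> n\<^sub>1 \<mu> t = foot p (Inv\<gamma> t) (n\<^sub>2 t)"
    by (metis contrapedal_eq_foot foot_scaleR_unit)
  also have "\<dots> = foot p (\<gamma> t) (n\<^sub>2 t)"
  proof (rule foot_cong_hprod)
    obtain f\<^sub>1 f\<^sub>2 where "Inv\<gamma> t = \<gamma> t + f\<^sub>1 t *\<^sub>R n\<^sub>1 t + f\<^sub>2 t *\<^sub>R hcross (n\<^sub>1 t) (n\<^sub>2 t)"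
      using assms(7) t unfolding is_involute_def frame_mu_def by blast
    moreover have "hprod (hcross (n\<^sub>1 t) (n\<^sub>2 t)) (n\<^sub>2 t) = 0"
      by (subst hprod_commute) (rule hprod_hcross_right)
    ultimately show "hprod (Inv\<gamma> t) (n\<^sub>2 t) = hprod (\<gamma> t) (n\<^sub>2 t)"
      by (simp add: hprod_add_left hprod_scaleR_left orth)
  qed
  also have "\<dots> = pedal p \<gamma> n\<^sub>1 n\<^sub>2 t"
    by (simp add: pedal_eq_foot)
  finally show "contrapedal p Inv\<gamma> n\<^sub>1 \<mu> t = pedal p \<gamma> n\<^sub>1 n\<^sub>2 t" .
qed

end
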